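(* Let $d,\nu\ge 1$ be integers and let $S\subset\{0,1\}^{\Lambda_\nu}$ be a parking scheme. Let $\mu_n$ be the distribution on $\{0,1\}^{\mathbb{Z}^d}$ of the jamming limit $P_n$ of the parking process on $\Lambda_n$ with null boundary condition, and let $\mu$ be the distribution of the limit algorithm $P$. If $L\subset\{0,1\}^{\mathbb{Z}^d}$ is a local set, then for every $\alpha>0$, $|\mu(L)-\mu_n(L)|=o(e^{-\alpha n})$ as $n\to\infty$.
   Context: Local set: a set $L\subset\{0,1\}^{\mathbb{Z}^d}$ for which there exist $m\in\mathbb{N}$ and $\tilde L\subset\{0,1\}^{\Lambda_m}$ such that $\eta\in L\Leftrightarrow\eta|_{\Lambda_m}\in\tilde L$. Probability space: $\Omega=(0,1)^{\mathbb{Z}^d}$ with product Borel $\sigma$-algebra and the product $\lambda_{(0,1)}^{\mathbb{Z}^d}$ of Lebesgue measures on $(0,1)$. The space $\{0,1\}^{\mathbb{Z}^d}$ carries the product $\sigma$-algebra. $|x|_{\sup}=\max_i|x_i|$; $\Lambda_n=\{-n,\dots,n\}^d$. Parking scheme: a subset $S\subset\{0,1\}^{\Lambda_\nu}$ containing the all-zero configuration; $\nu$ is its radius of interaction. Translation: $\theta_x(\eta)(z)=\eta(z+x)$. Parking process on a finite set $X\subset\mathbb{Z}^d$ with null boundary condition: for $\omega\in\Omega$ with pairwise distinct coordinates, start with $\eta=0^{\mathbb{Z}^d}$ and visit the sites of $X$ once each, in increasing order of the values $\omega(x)$; when visiting $x$, if the current configuration $\eta$ satisfies $\theta_x(\eta)|_{\Lambda_\nu}\in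 S$, then set $\eta(x)=1$, otherwise leave $\eta$ unchanged. The final configuration is denoted $P_X(\omega)\in\{0,1\}^{\mathbb{Z}^d}$ (the jamming limit). Put $P_n=P_{\Lambda_n}$. Armour: a path is a finite sequence $(x_i)_{0\le i\le m}$ in $\mathbb{Z}^d$ ($m\ge 0$) with $|x_{i+1}-x_i|_{\sup}\le\nu$ for all $i$; it is decreasing (for $\omega$) if $\omega(x_0)>\omega(x_1)>\dots>\omega(x_m)$. Write $y\uparrow_{(\omega)}x$ if there is a decreasing path from $x_0=x$ to $x_m=y$ (so $x\uparrow_{(\omega)}x$). The armour of $X\subset\mathbb{Z}^d$ is $\mathcal{A}(X)(\omega)=\{y\in\mathbb{Z}^d:\exists x\in X,\ y\uparrow_{(\omega)}x\}$. Limit algorithm: $P(\omega)(x)=P_{\mathcal{A}(\{x\})(\omega)}(\omega)(x)$ for all $x\in\mathbb{Z}^d$. Convention: on the exceptional set of $\omega$ having two equal coordinates, or for which an infinite decreasing path exists (equivalently some $\mathcal{A}(\{x\})(\omega)$ is infinite, when the coordinates are distinct), set $P_n(\omega)=P(\omega)=0^{\mathbb{Z}^d}$ for all $n$. *)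

theory Defs
  imports "HOL-Probability.Probability" "HOL-Library.Landau_Symbols"
begin

text \<open>
  The lattice \<open>\<int>\<^sup>d\<close> is \<^typ>\<open>int ^ 'd\<close> with \<open>d = CARD('d) \<ge> 1\<close>.  In configurations,
  \<^const>\<open>True\<close> and \<^const>\<open>False\<close> stand for 1 and 0.  Elements of \<open>{0,1}\<^bsup>A\<^esup>\<close> are the
  extensional functions in \<open>A \<rightarrow>\<^sub>E UNIV\<close>, and \<open>\<eta>|\<^sub>A\<close> is \<open>restrict \<eta> A\<close>.
\<close>

type_synonym 'd site = "int ^ 'd"
type_synonym 'd config = "int ^ 'd \<Rightarrow> bool"

definition sup_norm :: "'d::finite site \<Rightarrow> int" where
  "sup_norm x = Max (range (\<lambda>i. \<bar>x $ i\<bar>))"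

definition box :: "nat \<Rightarrow> 'd::finite site set" where
  "box n = {x. \<forall>i. x $ i \<in> {- int n..int n}}"

definition local_set :: "'d::finite config set \<Rightarrow> bool" where
  "local_set L \<longleftrightarrow>
     (\<exists>m. \<exists>L' \<subseteq> (box m \<rightarrow>\<^sub>E UNIV). \<forall>\<eta>. \<eta> \<in> L \<longleftrightarrow> restrict \<eta> (box m) \<in> L')"

definition config_space :: "'d::finite config measure" where
  "config_space = PiM UNIV (\<lambda>_. count_space UNIV)"

definition omega_space :: "('d::finite site \<Rightarrow> real) measure" where
  "omega_space = PiM UNIV (\<lambda>_. restrict_space lborel {0<..<1})"

definition zero_config :: "'d::finite config" where
  "zero_config = (\<lambda>_. False)"

definition translate :: "'d::finite site \<Rightarrow> 'd config \<Rightarrow> 'd config" where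
  "translate x \<eta> = (\<lambda>z. \<eta> (z + x))"

definition parking_scheme :: "nat \<Rightarrow> 'd::finite config set \<Rightarrow> bool" where
  "parking_scheme \<nu> S \<longleftrightarrow> S \<subseteq> (box \<nu> \<rightarrow>\<^sub>E UNIV) \<and> restrict zero_config (box \<nu>) \<in> S"

definition park_at ::
    "nat \<Rightarrow> 'd::finite config set \<Rightarrow> 'd site \<Rightarrow> 'd config \<Rightarrow> 'd config" where
  "park_at \<nu> S x \<eta> =
     (if restrict (translate x \<eta>) (box \<nu>) \<in> S then \<eta>(x := True) else \<eta>)"

text \<open>
  The process on \<open>X\<close>, meaningful for finite \<open>X\<close> and injective \<open>\<omega>\<close>: the list below then
  enumerates \<open>X\<close> once each in increasing order of \<open>\<omega>\<close>, and \<^const>\<open>fold\<close> visits it from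
  left to right.
\<close>

definition park ::
    "nat \<Rightarrow> 'd::finite config set \<Rightarrow> 'd site set \<Rightarrow> ('d site \<Rightarrow> real) \<Rightarrow> 'd config" where
  "park \<nu> S X \<omega> = fold (park_at \<nu> S) (sorted_key_list_of_set \<omega> X) zero_config"

text \<open>The finite path \<open>p 0, \<dots>, p m\<close>; the values of \<open>p\<close> beyond \<open>m\<close> are irrelevant.\<close>

definition decreasing_path ::
    "nat \<Rightarrow> ('d::finite site \<Rightarrow> real) \<Rightarrow> nat \<Rightarrow> (nat \<Rightarrow> 'd site) \<Rightarrow> bool" where
  "decreasing_path \<nu> \<omega> m p \<longleftrightarrow>
     (\<forall>i<m. sup_norm (p (Suc i) - p i) \<le> int \<nu> \<and> \<omega> (p i) > \<omega> (p (Suc i)))"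

definition armour ::
    "nat \<Rightarrow> 'd::finite site set \<Rightarrow> ('d site \<Rightarrow> real) \<Rightarrow> 'd site set" where
  "armour \<nu> X \<omega> = {y. \<exists>x\<in>X. \<exists>m p. decreasing_path \<nu> \<omega> m p \<and> p 0 = x \<and> p m = y}"

definition exceptional :: "nat \<Rightarrow> ('d::finite site \<Rightarrow> real) \<Rightarrow> bool" where
  "exceptional \<nu> \<omega> \<longleftrightarrow>
     \<not> inj \<omega> \<or>
     (\<exists>p. \<forall>i. sup_norm (p (Suc i) - p i) \<le> int \<nu> \<and> \<omega> (p i) > \<omega> (p (Suc i)))"

definition P_box ::
    "nat \<Rightarrow> 'd::finite config set \<Rightarrow> nat \<Rightarrow> ('d site \<Rightarrow> real) \<Rightarrow> 'd config" where
  "P_box \<nu> S n \<omega> = (if exceptional \<nu> \<omega> then zero_config else park \<nu> S (box n) \<omega>)"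

definition P_limit ::
    "nat \<Rightarrow> 'd::finite config set \<Rightarrow> ('d site \<Rightarrow> real) \<Rightarrow> 'd config" where
  "P_limit \<nu> S \<omega> =
     (if exceptional \<nu> \<omega> then zero_config
      else (\<lambda>x. park \<nu> S (armour \<nu> {x} \<omega>) \<omega> x))"

definition mu_box :: "nat \<Rightarrow> 'd::finite config set \<Rightarrow> nat \<Rightarrow> 'd config measure" where
  "mu_box \<nu> S n = distr omega_space config_space (P_box \<nu> S n)"

definition mu_limit :: "nat \<Rightarrow> 'd::finite config set \<Rightarrow> 'd config measure" where
  "mu_limit \<nu> S = distr omega_space config_space (P_limit \<nu> S)"

end

theory Submission
  imports Defs "HOL-Combinatorics.Multiset_Permutations"
begin

text \<open>
  Two facts carry the proof.  First, information travels only along decreasing paths: when a site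
  is visited, its fate depends on neighbours within distance \<open>\<nu>\<close> that were visited earlier, and
  theirs on neighbours visited still earlier.  So as soon as the armour of \<open>x\<close> is contained in
  the box of radius \<open>n\<close>, the process on that box and the limit algorithm give \<open>x\<close> the same
  value (\<open>P_limit_eq_P_box\<close>).

  Secondly, long decreasing paths are extremely rare.  If the armour of a site \<open>x\<close> in the box of
  radius \<open>m\<close> leaves the box of radius \<open>n\<close>, then a decreasing path of \<open>k = (n - m) div \<nu>\<close> steps
  starts at \<open>x\<close>.  Independent uniform labels are equally likely to occur in any order, so a given
  walk through \<open>k + 1\<close> distinct sites is decreasing with probability at most \<open>1 / (k + 1)!\<close>
  (\<open>prob_decreasing_le\<close>), whereas only \<open>C\<^sup>k\<close> walks of \<open>k\<close> steps leave \<open>x\<close>, where \<open>C\<close> is the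
  number of sites in the box of radius \<open>\<nu>\<close>.  For a local set read off from the box of radius
  \<open>m\<close> the two probabilities therefore differ by at most a constant times \<open>C\<^sup>k / k!\<close>
  (\<open>measure_diff_le\<close>).  As \<open>k\<close> grows linearly in \<open>n\<close>, the factorial beats every exponential.

  On exceptional configurations of labels both algorithms return the zero configuration, so these
  contribute nothing to the difference.  They have to form a measurable set for the two
  distributions to be meaningful.  The existence of an infinite path is an uncountable union of events; Koenig's lemma
  (\<open>infinite_path_iff_descends\<close>) turns it into a countable combination of events.
\<close>

section \<open>Boxes in the lattice\<close>

lemma sup_norm_le_iff_box: "sup_norm x \<le> int n \<longleftrightarrow> x \<in> box n"
  unfolding sup_norm_def box_def by (auto simp: abs_le_iff minus_le_iff)

lemma finite_box [simp]: "finite (box n :: 'd::finite site set)"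
proof -
  have "(box n :: 'd site set) \<subseteq> vec_lambda ` (UNIV \<rightarrow>\<^sub>E {- int n..int n})"
  proof
    fix x :: "'d site" assume "x \<in> box n"
    then have "x = vec_lambda (vec_nth x)" "vec_nth x \<in> UNIV \<rightarrow>\<^sub>E {- int n..int n}"
      by (auto simp: box_def)
    then show "x \<in> vec_lambda ` (UNIV \<rightarrow>\<^sub>E {- int n..int n})" by (rule image_eqI)
  qed
  then show ?thesis by (rule finite_subset) (auto intro!: finite_PiE)
qed

lemma box_mono: "m \<le> n \<Longrightarrow> box m \<subseteq> box n"
  by (simp add: subset_iff sup_norm_le_iff_box [symmetric])

lemma box_add: "x \<in> box m \<Longrightarrow> u \<in> box n \<Longrightarrow> x + u \<in> box (m + n)"
  unfolding box_def by (auto; smt (verit))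

lemma box_exhausts: "\<exists>n. x \<in> box n"
proof -
  have "0 \<le> sup_norm x"
    unfolding sup_norm_def by (subst Max_ge_iff) auto
  then have "x \<in> box (nat (sup_norm x))"
    by (simp add: sup_norm_le_iff_box [symmetric])
  then show ?thesis ..
qed

section \<open>Locality of the parking process\<close>

lemma park_at_other: "y \<noteq> x \<Longrightarrow> park_at \<nu> S x \<eta> y = \<eta> y"
  by (simp add: park_at_def)

lemma fold_park_at_occupied: "fold (park_at \<nu> S) xs zero_config y \<Longrightarrow> y \<in> set xs"
proof (induction xs rule: rev_induct)
  case (snoc x xs)
  then show ?case by (cases "y = x") (auto simp: park_at_other)
qed (simp add: zero_config_def)

text \<open>
  Locality, for a set \<open>A\<close> that is closed under passing to earlier neighbours: deleting the sites
  outside \<open>A\<close> from the schedule is invisible on \<open>A\<close>.  The induction follows the schedule.  When a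
  site of \<open>A\<close> is visited, the window around it contains, outside \<open>A\<close>, only sites that have not
  been visited, and these are empty in both runs.
\<close>

lemma fold_park_at_filter:
  assumes "sorted_wrt (\<lambda>a b. \<omega> a < \<omega> b) xs"
    and "\<And>y z. y \<in> A \<Longrightarrow> sup_norm (z - y) \<le> int \<nu> \<Longrightarrow> \<omega> z < \<omega> y \<Longrightarrow> z \<in> A"
    and "y \<in> A"
  shows "fold (park_at \<nu> S) xs zero_config y
    = fold (park_at \<nu> S) (filter (\<lambda>x. x \<in> A) xs) zero_config y"
  using assms(1,3)
proof (induction xs arbitrary: y rule: rev_induct)
  case (snoc x xs)
  let ?f = "fold (park_at \<nu> S) xs zero_config"
  let ?g = "fold (park_at \<nu> S) (filter (\<lambda>x. x \<in> A) xs) zero_config"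
  have agree: "?f y = ?g y" if "y \<in> A" for y
    using snoc that by (simp add: sorted_wrt_append)
  show ?case
  proof (cases "x \<in> A")
    case False
    then show ?thesis using agree snoc.prems park_at_other[of y x \<nu> S ?f] by auto
  next
    case True
    have "translate x ?f z = translate x ?g z" if "z \<in> box \<nu>" for z
    proof (cases "z + x \<in> A")
      case True
      then show ?thesis by (simp add: translate_def agree)
    next
      \<comment> \<open>a site of \<open>xs\<close> seen from \<open>x\<close> has been visited before \<open>x\<close>, hence lies in \<open>A\<close>\<close>
      case False
      have "z + x \<notin> set xs"
      proof
        assume "z + x \<in> set xs"
        then have "\<omega> (z + x) < \<omega> x" using snoc.prems(1) by (simp add: sorted_wrt_append)
        moreover have "sup_norm (z + x - x) \<le> int \<nu>"
          using that by (simp add: sup_norm_le_iff_box)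
        ultimately show False using False assms(2) \<open>x \<in> A\<close> by blast
      qed
      then have "\<not> ?f (z + x)" "\<not> ?g (z + x)"
        using fold_park_at_occupied[of \<nu> S xs "z + x"]
          fold_park_at_occupied[of \<nu> S "filter (\<lambda>x. x \<in> A) xs" "z + x"] by auto
      then show ?thesis by (simp add: translate_def)
    qed
    then have "restrict (translate x ?f) (box \<nu>) = restrict (translate x ?g) (box \<nu>)"
      by (intro restrict_ext)
    then have "park_at \<nu> S x ?f y = park_at \<nu> S x ?g y"
      using agree snoc.prems by (auto simp: park_at_def)
    then show ?thesis using True by simp
  qed
qed simp

text \<open>
  The next two lemmas describe the schedule of the process as the unique enumeration along which
  the labels increase; proofs about the process can then work with an arbitrary such list.
\<close>

lemma (in linorder) sorted_key_list_of_set_eq_sorted_wrt: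
  assumes "inj f" "sorted_wrt (\<lambda>a b. f a < f b) xs"
  shows "sorted_key_list_of_set f (set xs) = xs"
proof -
  interpret folding_insort_key "(\<le>)" "(<)" UNIV f
    by standard (rule assms(1))
  have "sorted_wrt (<) (map f xs)" using assms(2) by (simp add: sorted_wrt_map)
  then have "sorted (map f xs)" "distinct (map f xs)"
    by (auto simp: strict_sorted_iff)
  then show ?thesis by (intro idem_if_sorted_distinct) (auto simp: distinct_map)
qed

lemma (in linorder) ex_sorted_wrt_enumeration:
  assumes "inj f" "finite X"
  obtains xs where "set xs = X" "sorted_wrt (\<lambda>a b. f a < f b) xs"
proof -
  interpret folding_insort_key "(\<le>)" "(<)" UNIV f
    by standard (rule assms(1))
  have "sorted_wrt (<) (map f (sorted_key_list_of_set f X))"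
    by (intro strict_sorted_key_list_of_set) simp
  then show thesis
    using assms by (intro that[of "sorted_key_list_of_set f X"]) (auto simp: sorted_wrt_map)
qed

lemma park_eq_fold:
  assumes "inj \<omega>" "sorted_wrt (\<lambda>a b. \<omega> a < \<omega> b) xs"
  shows "park \<nu> S (set xs) \<omega> = fold (park_at \<nu> S) xs zero_config"
  using assms by (simp add: park_def sorted_key_list_of_set_eq_sorted_wrt)

lemma park_eq_park_subset:
  assumes "inj \<omega>" "finite X" "A \<subseteq> X" "y \<in> A"
    and "\<And>y z. y \<in> A \<Longrightarrow> sup_norm (z - y) \<le> int \<nu> \<Longrightarrow> \<omega> z < \<omega> y \<Longrightarrow> z \<in> A"
  shows "park \<nu> S X \<omega> y = park \<nu> S A \<omega> y"
proof -
  obtain xs where xs: "set xs = X" "sorted_wrt (\<lambda>a b. \<omega> a < \<omega> b) xs"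
    using ex_sorted_wrt_enumeration assms(1,2) by blast
  have "sorted_wrt (\<lambda>a b. \<omega> a < \<omega> b) (filter (\<lambda>x. x \<in> A) xs)"
    using xs(2) by (rule sorted_wrt_filter)
  moreover have "set (filter (\<lambda>x. x \<in> A) xs) = A" using xs(1) assms(3) by auto
  ultimately show ?thesis
    using park_eq_fold[OF assms(1)] fold_park_at_filter[of \<omega> xs A \<nu> y S] xs assms by metis
qed

lemma armour_refl: "x \<in> armour \<nu> {x} \<omega>"
  unfolding armour_def decreasing_path_def by (auto intro!: exI[of _ 0])

text \<open>
  Armours are exactly the kind of set to which locality applies: a decreasing path can be
  prolonged by any earlier neighbour of its endpoint.
\<close>

lemma armour_closed:
  assumes "y \<in> armour \<nu> X \<omega>" "sup_norm (z - y) \<le> int \<nu>" "\<omega> z < \<omega> y"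
  shows "z \<in> armour \<nu> X \<omega>"
proof -
  obtain x m p where "x \<in> X" and p: "decreasing_path \<nu> \<omega> m p" "p 0 = x" "p m = y"
    using assms(1) unfolding armour_def by blast
  have "decreasing_path \<nu> \<omega> (Suc m) (p(Suc m := z))"
    using p assms(2,3) unfolding decreasing_path_def by (auto simp: less_Suc_eq)
  then have "\<exists>m p. decreasing_path \<nu> \<omega> m p \<and> p 0 = x \<and> p m = z"
    using p(2) by (intro exI[of _ "Suc m"] exI[of _ "p(Suc m := z)"]) simp
  then show ?thesis using \<open>x \<in> X\<close> unfolding armour_def by blast
qed

lemma P_limit_eq_P_box:
  assumes "armour \<nu> {x} \<omega> \<subseteq> box n"
  shows "P_limit \<nu> S \<omega> x = P_box \<nu> S n \<omega> x"
proof (cases "exceptional \<nu> \<omega>")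
  case False
  then have "inj \<omega>" by (simp add: exceptional_def)
  then have "park \<nu> S (box n) \<omega> x = park \<nu> S (armour \<nu> {x} \<omega>) \<omega> x"
    using assms armour_closed[of _ \<nu> "{x}" \<omega>] by (intro park_eq_park_subset) (auto intro: armour_refl)
  then show ?thesis using False by (simp add: P_limit_def P_box_def)
qed (simp add: P_limit_def P_box_def)

section \<open>Long decreasing paths\<close>

text \<open>
  A decreasing path of \<open>k\<close> steps starts at \<open>x\<close>.  The recursion over \<open>k\<close> quantifies over one step at
  a time, from a finite set, instead of over whole paths; this makes the predicate an event and
  lets walks be counted by their lists of steps.
\<close>

primrec descends :: "nat \<Rightarrow> ('d::finite site \<Rightarrow> real) \<Rightarrow> nat \<Rightarrow> 'd site \<Rightarrow> bool" where
  "descends \<nu> \<omega> 0 x = True"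
| "descends \<nu> \<omega> (Suc k) x = (\<exists>u\<in>box \<nu>. \<omega> (x + u) < \<omega> x \<and> descends \<nu> \<omega> k (x + u))"

lemma descends_decreasing_path:
  assumes "decreasing_path \<nu> \<omega> k p"
  shows "descends \<nu> \<omega> k (p 0)"
  using assms
proof (induction k arbitrary: p)
  case (Suc k)
  then have "descends \<nu> \<omega> k (p (Suc 0))"
    using Suc.IH[of "\<lambda>i. p (Suc i)"] by (auto simp: decreasing_path_def)
  moreover have "p (Suc 0) - p 0 \<in> box \<nu>" "\<omega> (p (Suc 0)) < \<omega> (p 0)"
    using Suc.prems by (auto simp: decreasing_path_def sup_norm_le_iff_box)
  ultimately show ?case by (auto intro!: bexI[of _ "p (Suc 0) - p 0"])
qed simp

lemma descends_mono: "descends \<nu> \<omega> k x \<Longrightarrow> j \<le> k \<Longrightarrow> descends \<nu> \<omega> j x"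
proof (induction k arbitrary: j x)
  case (Suc k)
  then show ?case by (cases j) auto
qed simp

text \<open>
  A path that leaves the large box needs at least \<open>k\<close> steps, since each step covers a distance of
  at most \<open>\<nu>\<close>.
\<close>

lemma armour_subset_box:
  assumes "\<not> descends \<nu> \<omega> k x" "x \<in> box m" "m + k * \<nu> \<le> n"
  shows "armour \<nu> {x} \<omega> \<subseteq> box n"
proof
  fix y assume "y \<in> armour \<nu> {x} \<omega>"
  then obtain j p where p: "decreasing_path \<nu> \<omega> j p" "p 0 = x" "p j = y"
    unfolding armour_def by blast
  then have "j < k"
    using assms(1) descends_decreasing_path descends_mono by (metis not_le)
  have "p i \<in> box (m + i * \<nu>)" if "i \<le> j" for i
    using that
  proof (induction i)
    case (Suc i)
    then have "p (Suc i) - p i \<in> box \<nu>"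
      using p(1) by (auto simp: decreasing_path_def sup_norm_le_iff_box)
    with Suc show ?case using box_add[of "p i" "m + i * \<nu>" "p (Suc i) - p i" \<nu>] by (simp add: add_ac)
  qed (use p assms in simp)
  then have "y \<in> box (m + j * \<nu>)" using p by blast
  moreover have "m + j * \<nu> \<le> n"
    using \<open>j < k\<close> assms(3) by (meson add_le_mono le_refl le_trans less_imp_le mult_le_mono1)
  ultimately show "y \<in> box n" using box_mono by blast
qed

text \<open>
  Koenig's lemma: every site has finitely many neighbours, so a site from which arbitrarily long
  decreasing paths start has an earlier neighbour with the same property; iterating this choice
  produces an infinite path.
\<close>

lemma infinite_path_iff_descends:
  "(\<exists>p. \<forall>i. sup_norm (p (Suc i) - p i) \<le> int \<nu> \<and> \<omega> (p i) > \<omega> (p (Suc i)))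
    \<longleftrightarrow> (\<exists>x. \<forall>k. descends \<nu> \<omega> k x)" (is "?L \<longleftrightarrow> ?R")
proof
  assume ?L
  then obtain p where "\<forall>i. sup_norm (p (Suc i) - p i) \<le> int \<nu> \<and> \<omega> (p i) > \<omega> (p (Suc i))" ..
  then have "\<forall>k. decreasing_path \<nu> \<omega> k p" by (simp add: decreasing_path_def)
  then show ?R using descends_decreasing_path by blast
next
  assume ?R
  have step: "\<exists>y. (\<forall>k. descends \<nu> \<omega> k y) \<and> (sup_norm (y - x) \<le> int \<nu> \<and> \<omega> x > \<omega> y)"
    if "\<forall>k. descends \<nu> \<omega> k x" for x
  proof (rule ccontr)
    assume "\<not> ?thesis"
    then have "\<forall>u\<in>box \<nu>. \<exists>k. \<omega> (x + u) < \<omega> x \<longrightarrow> \<not> descends \<nu> \<omega> k (x + u)"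
      by (metis add_diff_cancel_left' sup_norm_le_iff_box)
    then obtain K where K: "\<forall>u\<in>box \<nu>. \<omega> (x + u) < \<omega> x \<longrightarrow> \<not> descends \<nu> \<omega> (K u) (x + u)"
      by metis
    \<comment> \<open>beyond \<open>N\<close> steps, no earlier neighbour of \<open>x\<close> admits a continuation\<close>
    define N where "N = Max (insert 0 (K ` box \<nu>))"
    have "K u \<le> N" if "u \<in> box \<nu>" for u using that by (simp add: N_def)
    moreover have "descends \<nu> \<omega> (Suc N) x" using that by blast
    ultimately show False using K descends_mono[of \<nu> \<omega> N] by auto
  qed
  from \<open>?R\<close> have "\<exists>x. \<forall>k. descends \<nu> \<omega> k x" .
  from dependent_nat_choice[OF this, of "\<lambda>_ x y. sup_norm (y - x) \<le> int \<nu> \<and> \<omega> x > \<omega> y"] step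
  show ?L by blast
qed

text \<open>
  Outside the exceptional set every armour is finite, hence contained in all large boxes.  This
  makes the limit algorithm a pointwise limit of the processes on boxes, and gives its
  measurability below.
\<close>

lemma P_limit_eventually_P_box:
  assumes "\<not> exceptional \<nu> \<omega>"
  shows "\<exists>N. \<forall>n\<ge>N. P_limit \<nu> S \<omega> x = P_box \<nu> S n \<omega> x"
proof -
  obtain k where k: "\<not> descends \<nu> \<omega> k x"
    using assms infinite_path_iff_descends[of \<nu> \<omega>] unfolding exceptional_def by blast
  obtain m where "x \<in> box m" using box_exhausts by blast
  then show ?thesis
    using P_limit_eq_P_box armour_subset_box[OF k] by blast
qed

section \<open>Measurability\<close>

lemma prob_space_uniform: "prob_space (restrict_space lborel {0<..<1::real})"
  by (rule prob_spaceI) (simp add: emeasure_restrict_space space_restrict_space)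

lemma prob_space_omega_space: "prob_space (omega_space :: ('d::finite site \<Rightarrow> real) measure)"
  unfolding omega_space_def by (intro prob_space_PiM prob_space_uniform)

lemma measurable_omega_coordinate [measurable]: "(\<lambda>\<omega>. \<omega> x) \<in> borel_measurable omega_space"
proof -
  have "(\<lambda>\<omega>. \<omega> x) \<in> omega_space \<rightarrow>\<^sub>M restrict_space lborel {0<..<1}"
    unfolding omega_space_def by measurable
  then show ?thesis by (simp add: measurable_restrict_space2_iff)
qed

lemma pred_sorted_wrt [measurable]:
  assumes [measurable]: "\<And>a b. Measurable.pred M (\<lambda>\<omega>. R \<omega> a b)"
  shows "Measurable.pred M (\<lambda>\<omega>. sorted_wrt (R \<omega>) xs)"
proof (induction xs)
  case (Cons x xs)
  note [measurable] = this
  show ?case unfolding sorted_wrt.simps by measurable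
qed simp

lemma pred_descends [measurable]: "Measurable.pred omega_space (\<lambda>\<omega>. descends \<nu> \<omega> k x)"
proof (induction k arbitrary: x)
  case (Suc k)
  note [measurable] = this
  show ?case unfolding descends.simps by (intro pred_intros_finite) measurable
qed simp

lemma pred_exceptional [measurable]:
  "Measurable.pred omega_space (exceptional \<nu> :: ('a::finite site \<Rightarrow> real) \<Rightarrow> bool)"
proof -
  have inj_iff: "inj \<omega> \<longleftrightarrow> (\<forall>x y. x = y \<or> \<omega> x < \<omega> y \<or> \<omega> y < \<omega> x)" for \<omega> :: "'a site \<Rightarrow> real"
    unfolding inj_def by (metis less_irrefl linorder_less_linear)
  have "Measurable.pred omega_space (\<lambda>\<omega> :: 'a site \<Rightarrow> real. x = y \<or> \<omega> x < \<omega> y \<or> \<omega> y < \<omega> x)" for x y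
    by (cases "x = y") (simp, simp, measurable)
  then have [measurable]: "Measurable.pred omega_space (inj :: ('a site \<Rightarrow> real) \<Rightarrow> bool)"
    unfolding inj_iff by (intro pred_intros_countable)
  have [measurable]: "Measurable.pred omega_space (\<lambda>\<omega>. \<exists>x :: 'a site. \<forall>k. descends \<nu> \<omega> k x)"
    by (intro pred_intros_countable pred_descends)
  show ?thesis unfolding exceptional_def infinite_path_iff_descends by measurable
qed

text \<open>
  The schedule depends on the labels, but there are only countably many lists of sites that it can
  be.  Quantifying over them displays the process as a countable union of order events.
\<close>

lemma P_box_iff:
  "P_box \<nu> S n \<omega> x \<longleftrightarrow> \<not> exceptional \<nu> \<omega> \<and>
    (\<exists>xs. set xs = box n \<and> sorted_wrt (\<lambda>a b. \<omega> a < \<omega> b) xs \<and> fold (park_at \<nu> S) xs zero_config x)"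
proof (cases "exceptional \<nu> \<omega>")
  case False
  then have "inj \<omega>" by (simp add: exceptional_def)
  moreover obtain xs where "set xs = box n" "sorted_wrt (\<lambda>a b. \<omega> a < \<omega> b) xs"
    using ex_sorted_wrt_enumeration[OF \<open>inj \<omega>\<close> finite_box] .
  moreover have "fold (park_at \<nu> S) ys zero_config = park \<nu> S (box n) \<omega>"
    if "set ys = box n" "sorted_wrt (\<lambda>a b. \<omega> a < \<omega> b) ys" for ys
    using park_eq_fold[OF \<open>inj \<omega>\<close> that(2)] that(1) by simp
  ultimately show ?thesis using False by (auto simp: P_box_def)
qed (simp add: P_box_def zero_config_def)

lemma pred_P_box [measurable]: "Measurable.pred omega_space (\<lambda>\<omega>. P_box \<nu> S n \<omega> x)"
  unfolding P_box_iff by measurable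

lemma pred_P_limit [measurable]: "Measurable.pred omega_space (\<lambda>\<omega>. P_limit \<nu> S \<omega> x)"
proof -
  have "P_limit \<nu> S \<omega> x \<longleftrightarrow> (\<exists>N. \<forall>n\<ge>N. P_box \<nu> S n \<omega> x)" for \<omega>
  proof (cases "exceptional \<nu> \<omega>")
    case False
    then obtain N where "\<forall>n\<ge>N. P_limit \<nu> S \<omega> x = P_box \<nu> S n \<omega> x"
      using P_limit_eventually_P_box by blast
    then show ?thesis by (metis le_cases)
  qed (auto simp: P_limit_def P_box_def zero_config_def)
  then show ?thesis by simp
qed

lemma measurable_config_spaceI:
  assumes "\<And>x. Measurable.pred M (\<lambda>\<omega>. F \<omega> x)"
  shows "F \<in> M \<rightarrow>\<^sub>M config_space"
proof -
  have "(\<lambda>\<omega> x. F \<omega> x) \<in> M \<rightarrow>\<^sub>M config_space"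
    unfolding config_space_def using assms by (intro measurable_PiM_single') auto
  then show ?thesis by simp
qed

lemma local_set_measurable:
  assumes "local_set L"
  shows "L \<in> sets config_space"
proof -
  obtain m L' where L': "L' \<subseteq> box m \<rightarrow>\<^sub>E UNIV" "\<forall>\<eta>. \<eta> \<in> L \<longleftrightarrow> restrict \<eta> (box m) \<in> L'"
    using assms unfolding local_set_def by blast
  have "(\<lambda>\<eta>. restrict \<eta> (box m)) \<in> config_space \<rightarrow>\<^sub>M PiM (box m) (\<lambda>_. count_space (UNIV::bool set))"
    unfolding config_space_def by (rule measurable_restrict_subset) simp
  moreover have "L' \<in> sets (PiM (box m) (\<lambda>_. count_space (UNIV::bool set)))"
    using L'(1) by (simp add: count_space_PiM_finite)
  ultimately have "(\<lambda>\<eta>. restrict \<eta> (box m)) -` L' \<inter> space config_space \<in> sets config_space"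
    by (rule measurable_sets)
  also have "(\<lambda>\<eta>. restrict \<eta> (box m)) -` L' \<inter> space config_space = L"
    using L'(2) by (auto simp: config_space_def space_PiM)
  finally show ?thesis .
qed

section \<open>Long decreasing paths are improbable\<close>

lemma decreasing_enumeration_unique:
  fixes f :: "'a \<Rightarrow> 'b::linorder"
  assumes "sorted_wrt (\<lambda>a b. f b < f a) ys" "sorted_wrt (\<lambda>a b. f b < f a) zs" "set ys = set zs"
  shows "ys = zs"
  using assms
proof (induction ys arbitrary: zs)
  case (Cons y ys)
  then obtain z zs' where zs: "zs = z # zs'" by (cases zs) auto
  \<comment> \<open>both heads are the unique maximiser of \<open>f\<close>\<close>
  have "y = z" using Cons.prems zs by (auto, metis insert_iff not_less_iff_gr_or_eq)
  moreover have "y \<notin> set ys" "z \<notin> set zs'" using Cons.prems zs by auto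
  ultimately have "set ys = set zs'" using Cons.prems(3) zs by (metis insert_ident list.simps(15))
  then show ?case using Cons zs \<open>y = z\<close> by simp
qed simp

text \<open>
  Exchangeability: the labels of any \<open>n\<close> distinct sites, in any order, have the same joint law,
  so the events that they decrease along the \<open>n!\<close> different orderings of the same sites are
  equally likely.  These events are disjoint, whence \<open>n!\<close> times their common probability is at
  most 1.
\<close>

lemma prob_decreasing_le:
  fixes xs :: "'d::finite site list"
  assumes "distinct xs"
  shows "measure omega_space {\<omega> \<in> space omega_space. sorted_wrt (\<lambda>a b. \<omega> b < \<omega> a) xs}
    \<le> 1 / fact (length xs)"
proof -
  interpret prob_space "omega_space :: ('d site \<Rightarrow> real) measure"
    by (rule prob_space_omega_space)
  define D :: "'d site list \<Rightarrow> ('d site \<Rightarrow> real) set" where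
    "D ys = {\<omega> \<in> space omega_space. sorted_wrt (\<lambda>a b. \<omega> b < \<omega> a) ys}" for ys
  define n where "n = length xs"
  define U where "U = restrict_space lborel {0<..<1::real}"
  define N where "N = PiM {..<n} (\<lambda>_. U)"
  define B where "B = {v \<in> space N. \<forall>j\<in>{..<n}. \<forall>i\<in>{..<j}. v j < v i}"
  have D_sets: "D ys \<in> events" for ys
    unfolding D_def by measurable
  have coordinate: "(\<lambda>v. v i) \<in> borel_measurable N" if "i < n" for i
  proof -
    have "(\<lambda>v. v i) \<in> N \<rightarrow>\<^sub>M U"
      unfolding N_def using that by (intro measurable_component_singleton) simp
    then show ?thesis by (simp add: U_def measurable_restrict_space2_iff)
  qed
  have B_sets: "B \<in> sets N"
  proof -
    have "Measurable.pred N (\<lambda>v. v j < v i)" if "j \<in> {..<n}" "i \<in> {..<j}" for i j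
      using that by (intro borel_measurable_pred_less coordinate) simp_all
    then have "Measurable.pred N (\<lambda>v. \<forall>j\<in>{..<n}. \<forall>i\<in>{..<j}. v j < v i)"
      by (intro pred_intros_finite(3) finite_lessThan)
    then show ?thesis unfolding B_def by (rule predE)
  qed
  \<comment> \<open>\<open>N\<close> is the law of the labels read along \<open>ys\<close>, whatever the ordering \<open>ys\<close>\<close>
  have prob_D: "prob (D ys) = measure N B" if ys: "ys \<in> permutations_of_set (set xs)" for ys
  proof -
    have len: "length ys = n" and "distinct ys"
      using ys assms length_finite_permutations_of_set[OF ys]
      by (auto simp: n_def distinct_card permutations_of_setD)
    let ?T = "\<lambda>\<omega>. \<lambda>i\<in>{..<n}. \<omega> (ys ! i)"
    have distr: "distr omega_space N ?T = N"
      unfolding omega_space_def N_def U_def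
      using distr_PiM_reindex[of UNIV "\<lambda>_. restrict_space lborel {0<..<1::real}" "nth ys" "{..<n}"]
        prob_space_uniform \<open>distinct ys\<close> len by (simp add: inj_on_nth)
    have T: "?T \<in> omega_space \<rightarrow>\<^sub>M N"
      unfolding omega_space_def N_def U_def by measurable
    have "measure N B = measure (distr omega_space N ?T) B" by (simp add: distr)
    also have "\<dots> = prob (?T -` B \<inter> space omega_space)"
      by (rule measure_distr[OF T B_sets])
    also have "?T -` B \<inter> space omega_space = D ys"
      using measurable_space[OF T] unfolding B_def D_def
      by (auto simp: sorted_wrt_iff_nth_less len)
    finally show ?thesis ..
  qed
  have disj: "disjoint_family_on D (permutations_of_set (set xs))"
    unfolding disjoint_family_on_def
    by (auto simp: D_def permutations_of_setD dest: decreasing_enumeration_unique)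
  have "fact n * measure N B = (\<Sum>ys\<in>permutations_of_set (set xs). prob (D ys))"
    using assms by (simp add: prob_D n_def distinct_card)
  also have "\<dots> = prob (\<Union>ys\<in>permutations_of_set (set xs). D ys)"
    using disj D_sets by (intro finite_measure_finite_Union [symmetric]) auto
  also have "\<dots> \<le> 1" by (rule prob_le_1)
  finally have "measure N B \<le> 1 / fact n" by (simp add: field_simps)
  moreover have "xs \<in> permutations_of_set (set xs)" using assms by auto
  ultimately show ?thesis using prob_D[of xs] by (simp add: D_def n_def)
qed

primrec walk :: "'a::plus \<Rightarrow> 'a list \<Rightarrow> 'a list" where
  "walk x [] = [x]"
| "walk x (u # us) = x # walk (x + u) us"

lemma length_walk [simp]: "length (walk x us) = Suc (length us)"
  by (induction us arbitrary: x) auto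

lemma descends_walk:
  assumes "descends \<nu> \<omega> k x"
  obtains us where "set us \<subseteq> box \<nu>" "length us = k" "sorted_wrt (\<lambda>a b. \<omega> b < \<omega> a) (walk x us)"
proof -
  have "\<exists>us. set us \<subseteq> box \<nu> \<and> length us = k \<and> sorted_wrt (\<lambda>a b. \<omega> b < \<omega> a) (walk x us)"
    using assms
  proof (induction k arbitrary: x)
    case (Suc k)
    then obtain u where u: "u \<in> box \<nu>" "\<omega> (x + u) < \<omega> x" "descends \<nu> \<omega> k (x + u)" by auto
    then obtain us where us: "set us \<subseteq> box \<nu>" "length us = k"
      "sorted_wrt (\<lambda>a b. \<omega> b < \<omega> a) (walk (x + u) us)" using Suc.IH by blast
    have "transp (\<lambda>a b. \<omega> b < \<omega> a)" by (auto intro: transpI)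
    moreover obtain zs where "walk (x + u) us = (x + u) # zs" by (cases us) auto
    ultimately have "sorted_wrt (\<lambda>a b. \<omega> b < \<omega> a) (walk x (u # us))"
      using us(3) u(2) by (auto simp: sorted_wrt2)
    then show ?case using us u by (intro exI[of _ "u # us"]) auto
  qed simp
  then show thesis using that by blast
qed

text \<open>
  A union bound over the lists of \<open>k\<close> steps.  A walk that visits a site twice cannot be
  decreasing; the other walks visit \<open>k + 1\<close> sites, and \<open>1 / (k + 1)!\<close> is relaxed to \<open>1 / k!\<close>.
\<close>

lemma prob_descends_le:
  fixes x :: "'d::finite site"
  shows "measure omega_space {\<omega> \<in> space omega_space. descends \<nu> \<omega> k x}
    \<le> real (card (box \<nu> :: 'd site set)) ^ k / fact k"
proof -
  interpret prob_space "omega_space :: ('d site \<Rightarrow> real) measure"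
    by (rule prob_space_omega_space)
  let ?D = "\<lambda>us. {\<omega> \<in> space omega_space. sorted_wrt (\<lambda>a b. \<omega> b < \<omega> a) (walk x us)}"
  let ?U = "{us. set us \<subseteq> (box \<nu> :: 'd site set) \<and> length us = k}"
  have fin: "finite ?U" by (rule finite_lists_length_eq) simp
  have D_le: "prob (?D us) \<le> 1 / fact k" if "us \<in> ?U" for us
  proof (cases "distinct (walk x us)")
    case True
    then have "prob (?D us) \<le> 1 / fact (Suc k)"
      using prob_decreasing_le[OF True] that by simp
    also have "\<dots> \<le> 1 / fact k"
      by (intro divide_left_mono fact_mono) auto
    finally show ?thesis .
  next
    case False
    have "distinct ys" if "sorted_wrt (\<lambda>a b. \<omega> b < \<omega> a) ys" for \<omega> :: "'d site \<Rightarrow> real" and ys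
      using that by (induction ys) auto
    then have empty: "?D us = {}" using False by auto
    show ?thesis unfolding empty by simp
  qed
  have "prob {\<omega> \<in> space omega_space. descends \<nu> \<omega> k x} \<le> prob (\<Union>us\<in>?U. ?D us)"
  proof (rule finite_measure_mono)
    show "{\<omega> \<in> space omega_space. descends \<nu> \<omega> k x} \<subseteq> (\<Union>us\<in>?U. ?D us)"
      by (auto elim!: descends_walk)
    show "(\<Union>us\<in>?U. ?D us) \<in> events" using fin by (intro sets.finite_UN) measurable
  qed
  also have "\<dots> \<le> (\<Sum>us\<in>?U. prob (?D us))"
    using fin by (intro finite_measure_subadditive_finite) auto
  also have "\<dots> \<le> (\<Sum>us\<in>?U. 1 / fact k)" by (rule sum_mono) (rule D_le)
  also have "\<dots> = real (card (box \<nu> :: 'd site set)) ^ k / fact k"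
    by (simp add: card_lists_length_eq)
  finally show ?thesis .
qed

section \<open>Comparison of the two distributions\<close>

text \<open>
  The process and the limit algorithm are run with the same labels.  They can disagree in the
  box of radius \<open>m\<close> only if a decreasing path of \<open>k\<close> steps starts there, and the difference of the
  two distributions on \<open>L\<close> is at most the probability of this event.
\<close>

lemma measure_diff_le:
  fixes L :: "'d::finite config set"
  assumes "L' \<subseteq> box m \<rightarrow>\<^sub>E UNIV" "\<forall>\<eta>. \<eta> \<in> L \<longleftrightarrow> restrict \<eta> (box m) \<in> L'" "m + k * \<nu> \<le> n"
  shows "\<bar>measure (mu_limit \<nu> S) L - measure (mu_box \<nu> S n) L\<bar>
    \<le> real (card (box m :: 'd site set)) * (real (card (box \<nu> :: 'd site set)) ^ k / fact k)"
proof -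
  interpret prob_space "omega_space :: ('d site \<Rightarrow> real) measure"
    by (rule prob_space_omega_space)
  let ?A = "P_limit \<nu> S -` L \<inter> space omega_space"
  let ?B = "P_box \<nu> S n -` L \<inter> space omega_space"
  let ?E = "\<lambda>x. {\<omega> \<in> space omega_space. descends \<nu> \<omega> k x}"
  let ?F = "\<Union>x\<in>(box m :: 'd site set). ?E x"
  have "local_set L"
    unfolding local_set_def using assms(1,2) by (intro exI[of _ m] exI[of _ L'] conjI)
  then have L: "L \<in> sets config_space" by (rule local_set_measurable)
  have P: "P_limit \<nu> S \<in> omega_space \<rightarrow>\<^sub>M config_space" "P_box \<nu> S n \<in> omega_space \<rightarrow>\<^sub>M config_space"
    by (rule measurable_config_spaceI, rule pred_P_limit)
      (rule measurable_config_spaceI, rule pred_P_box)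
  have A: "?A \<in> events" and B: "?B \<in> events" using P L by (auto intro: measurable_sets)
  have F: "?F \<in> events" by (intro sets.finite_UN finite_box) measurable
  have agree: "\<omega> \<in> ?A \<longleftrightarrow> \<omega> \<in> ?B" if "\<omega> \<in> space omega_space" "\<omega> \<notin> ?F" for \<omega>
  proof -
    have "P_limit \<nu> S \<omega> x = P_box \<nu> S n \<omega> x" if "x \<in> box m" for x
    proof (rule P_limit_eq_P_box, rule armour_subset_box)
      show "\<not> descends \<nu> \<omega> k x" using \<open>\<omega> \<notin> ?F\<close> \<open>\<omega> \<in> space omega_space\<close> that by auto
    qed (use that assms(3) in auto)
    then have "restrict (P_limit \<nu> S \<omega>) (box m) = restrict (P_box \<nu> S n \<omega>) (box m)"
      by (intro restrict_ext)
    then show ?thesis using assms(2) that(1) by simp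
  qed
  have "prob ?A \<le> prob (?B \<union> ?F)" "prob ?B \<le> prob (?A \<union> ?F)"
    using A B F agree by (intro finite_measure_mono; blast)+
  moreover have "prob (?B \<union> ?F) \<le> prob ?B + prob ?F" "prob (?A \<union> ?F) \<le> prob ?A + prob ?F"
    using A B F by (auto intro!: measure_Un_le)
  moreover have "measure (mu_limit \<nu> S) L = prob ?A" "measure (mu_box \<nu> S n) L = prob ?B"
    unfolding mu_limit_def mu_box_def using P L by (auto intro!: measure_distr)
  ultimately have "\<bar>measure (mu_limit \<nu> S) L - measure (mu_box \<nu> S n) L\<bar> \<le> prob ?F" by linarith
  also have "\<dots> \<le> (\<Sum>x\<in>(box m :: 'd site set). prob (?E x))"
    by (intro finite_measure_subadditive_finite) auto
  also have "\<dots> \<le> (\<Sum>x\<in>(box m :: 'd site set). real (card (box \<nu> :: 'd site set)) ^ k / fact k)"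
    by (intro sum_mono prob_descends_le)
  finally show ?thesis by simp
qed

theorem theorem5p2:
  fixes \<nu> :: nat
    and S L :: "'d::finite config set"
    and \<alpha> :: real
  assumes "\<nu> \<ge> 1"
    and "parking_scheme \<nu> S"
    and "local_set L"
    and "\<alpha> > 0"
  shows "(\<lambda>n. \<bar>measure (mu_limit \<nu> S) L - measure (mu_box \<nu> S n) L\<bar>)
           \<in> o(\<lambda>n. exp (- \<alpha> * real n))"
proof (rule smalloI_tendsto)
  obtain m L' where L': "L' \<subseteq> box m \<rightarrow>\<^sub>E UNIV" "\<forall>\<eta>. \<eta> \<in> L \<longleftrightarrow> restrict \<eta> (box m) \<in> L'"
    using assms(3) unfolding local_set_def by blast
  define K :: real where "K = card (box m :: 'd site set)"
  define C :: real where "C = card (box \<nu> :: 'd site set)"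
  define k where "k n = (n - m) div \<nu>" for n
  \<comment> \<open>as \<open>n \<le> m + \<nu> + k n * \<nu>\<close>, multiplying the bound by \<open>exp (\<alpha> * n)\<close> costs at most a factor
    \<open>exp (\<alpha> * (m + \<nu>))\<close>, absorbed in \<open>c\<close>, and a factor \<open>exp (\<alpha> * \<nu>)\<close> per step, absorbed in \<open>r\<close>\<close>
  define c where "c = K * exp (\<alpha> * real (m + \<nu>))"
  define r where "r = C * exp (\<alpha> * real \<nu>)"
  have "filterlim k at_top sequentially"
  proof (rule filterlim_at_top[THEN iffD2], rule allI)
    fix Z
    show "eventually (\<lambda>n. Z \<le> k n) sequentially"
      using eventually_ge_at_top[of "m + Z * \<nu>"]
    proof eventually_elim
      case (elim n)
      then have "Z * \<nu> \<le> n - m" by simp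
      then show ?case using assms(1) div_le_mono[of "Z * \<nu>" "n - m" \<nu>] by (simp add: k_def)
    qed
  qed
  moreover have "(\<lambda>j. r ^ j / fact j) \<longlonglongrightarrow> 0"
    using summable_LIMSEQ_zero[OF summable_exp[of r]] by (simp add: field_simps)
  ultimately have "(\<lambda>n. r ^ k n / fact (k n)) \<longlonglongrightarrow> 0"
    by (rule filterlim_compose[rotated])
  then have lim: "(\<lambda>n. c * (r ^ k n / fact (k n))) \<longlonglongrightarrow> 0"
    using tendsto_mult_right_zero by blast
  have bound: "norm (\<bar>measure (mu_limit \<nu> S) L - measure (mu_box \<nu> S n) L\<bar> / exp (- \<alpha> * real n))
      \<le> c * (r ^ k n / fact (k n))" if "n \<ge> m" for n
  proof -
    have "k n * \<nu> \<le> n - m" by (simp add: k_def)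
    then have le: "m + k n * \<nu> \<le> n" using that by simp
    have "n - m < (k n + 1) * \<nu>"
      using assms(1) by (simp add: k_def dividend_less_div_times)
    then have "n \<le> m + \<nu> + k n * \<nu>" by simp
    then have "real n \<le> real (m + \<nu>) + real (k n) * real \<nu>"
      by (metis of_nat_add of_nat_le_iff of_nat_mult)
    then have "\<alpha> * real n \<le> \<alpha> * real (m + \<nu>) + real (k n) * (\<alpha> * real \<nu>)"
      using mult_left_mono[of "real n" "real (m + \<nu>) + real (k n) * real \<nu>" \<alpha>] assms(4)
      by (simp add: algebra_simps)
    then have exp_le: "exp (\<alpha> * real n) \<le> exp (\<alpha> * real (m + \<nu>)) * exp (\<alpha> * real \<nu>) ^ k n"
      by (simp flip: exp_add exp_of_nat_mult)
    have "norm (\<bar>measure (mu_limit \<nu> S) L - measure (mu_box \<nu> S n) L\<bar> / exp (- \<alpha> * real n))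
        = \<bar>measure (mu_limit \<nu> S) L - measure (mu_box \<nu> S n) L\<bar> * exp (\<alpha> * real n)"
      by (simp add: exp_minus field_simps)
    also have "\<dots> \<le> (K * (C ^ k n / fact (k n))) * (exp (\<alpha> * real (m + \<nu>)) * exp (\<alpha> * real \<nu>) ^ k n)"
      using measure_diff_le[OF L' le] exp_le unfolding K_def C_def
      by (intro mult_mono) auto
    also have "\<dots> = c * (r ^ k n / fact (k n))"
      by (simp add: c_def r_def power_mult_distrib)
    finally show ?thesis .
  qed
  show "(\<lambda>n. \<bar>measure (mu_limit \<nu> S) L - measure (mu_box \<nu> S n) L\<bar> / exp (- \<alpha> * real n)) \<longlonglongrightarrow> 0"
    by (rule Lim_null_comparison[OF eventually_mono[OF eventually_ge_at_top[of m] bound] lim])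
qed simp

end
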